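(* For every $k\ge2$, $|E_k|\ge2$. Moreover, $a_k\ge3$ for every $k\ge3$, and every $k\ge 2$ with $k\equiv3$ or $5\pmod8$ has $|E_k|\ge3$. Consequently, as $K\to\infty$, $$\sum_{2\le k\le K}a_k\ge3K+O(1),\qquad \sum_{2\le k\le K}|E_k|\ge\frac94K+O(1).$$ More generally, for every $R\ge1$ there is a positive-density arithmetic progression of levels $k$ for which $|E_k|\ge R$ for all sufficiently large $k$ in that progression.
   Context: $\tau(n)$ is the number of positive divisors of $n$. For $k\ge2$, $$E_k=\{\tau(k^2-j)-j:\ 1\le j\le 2k-2,\ \tau(k^2-j)\ge j\},$$ $$a_k=\#\{1\le j\le 2k-2:\ \tau(k^2-j)\ge j\}.$$ *)

theory Defs
  imports Complex_Main "HOL-Library.Landau_Symbols" "HOL-Number_Theory.Cong"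
begin

definition tau :: "nat \<Rightarrow> nat" where
  "tau n = card {d. d dvd n}"

text \<open>For k at least 2, the bound 2 k - 2 is smaller than k^2, so neither natural-number
  subtraction below truncates.\<close>

definition admissible :: "nat \<Rightarrow> nat set" where
  "admissible k = {j. 1 \<le> j \<and> j \<le> 2 * k - 2 \<and> tau (k\<^sup>2 - j) \<ge> j}"

definition E :: "nat \<Rightarrow> int set" where
  "E k = {int (tau (k\<^sup>2 - j)) - int j | j. j \<in> admissible k}"

definition a :: "nat \<Rightarrow> nat" where
  "a k = card (admissible k)"

definition has_natural_density :: "nat set \<Rightarrow> real \<Rightarrow> bool" where
  "has_natural_density A d \<longleftrightarrow>
     (\<lambda>N. real (card {k \<in> A. 1 \<le> k \<and> k \<le> N}) / real N) \<longlonglongrightarrow> d"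

definition arith_prog :: "nat \<Rightarrow> nat \<Rightarrow> nat set" where
  "arith_prog r q = {r + n * q | n. True}"

end

theory Submission
  imports Defs
begin

text \<open>
  Everything rests on exact congruence information about the values \<open>tau (k\<^sup>2 - j) - j\<close>,
  which separates them without any knowledge of their size.

  For \<open>1 \<le> j \<le> 2 * k - 2\<close> the number \<open>k\<^sup>2 - j\<close> lies strictly between \<open>(k - 1)\<^sup>2\<close> and \<open>k\<^sup>2\<close>, so it
  is not a square and its divisors pair off as \<open>d \<leftrightarrow> n div d\<close>. Hence its \<open>tau\<close> is even and
  \<open>tau (k\<^sup>2 - j) - j\<close> has the parity of \<open>j\<close>. The offsets \<open>1\<close> and \<open>2\<close> are always admissible, the
  latter because an even positive number is at least \<open>2\<close>, and by parity they give two different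
  elements of \<open>E k\<close>. A third admissible offset is \<open>j = 4\<close>, because
  \<open>k\<^sup>2 - 4 = (k - 2) * (k + 2)\<close> has at least four divisors; only at \<open>k = 3\<close>, where one of these
  factors is \<open>1\<close>, must \<open>j = 3\<close> be taken instead.

  If \<open>k\<close> is \<open>3\<close> or \<open>5\<close> modulo \<open>8\<close>, then \<open>k\<^sup>2 - 1\<close> is \<open>8\<close> times an odd number and \<open>k\<^sup>2 - 3\<close> is \<open>2\<close>
  times an odd nonsquare. Both have \<open>tau\<close> divisible by \<open>4\<close>, so the two odd offsets \<open>1\<close> and \<open>3\<close>
  give values that differ modulo \<open>4\<close>, and \<open>j = 2\<close> still supplies an even one. Such \<open>k\<close> make up a
  quarter of all integers, whence the mean value \<open>2 + 1/4\<close>.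

  For arbitrary \<open>R\<close> the same idea is used with a larger modulus \<open>M = R\<^sup>2 + 1\<close> and square
  offsets. If a prime \<open>p > 2 * i\<close> divides \<open>k - i\<close> exactly \<open>M - 1\<close> times, it does not divide
  \<open>k + i\<close>, so it divides \<open>k\<^sup>2 - i\<^sup>2\<close> exactly \<open>M - 1\<close> times, and by multiplicativity
  \<open>tau (p ^ (M - 1)) = M\<close> divides \<open>tau (k\<^sup>2 - i\<^sup>2)\<close>. That makes \<open>i\<^sup>2\<close> admissible and its value congruent to \<open>- i\<^sup>2\<close> modulo \<open>M\<close>.
  With different primes for \<open>i = 1, \<dots>, R\<close>, the Chinese remainder theorem imposes all these
  conditions on a full residue class of \<open>k\<close>, and the \<open>R\<close> values are pairwise incongruent.
\<close>

section \<open>The divisor function\<close>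

text \<open>The map \<open>(x, y) \<mapsto> x * y\<close> on pairs of divisors is injective since \<open>x\<close> is recovered as
  \<open>gcd (x * y) m\<close>.\<close>

lemma tau_mult_coprime:
  assumes "coprime m n"
  shows "tau (m * n) = tau m * tau n"
proof -
  let ?D = "\<lambda>n::nat. {d. d dvd n}"
  let ?f = "\<lambda>(x::nat, y). x * y"
  have recover: "gcd (x * y) m = x \<and> gcd (x * y) n = y" if "x dvd m" "y dvd n" for x y
  proof
    have "coprime m y" "coprime n x"
      using that assms by (metis coprime_commute coprime_divisors dvd_refl)+
    then have "gcd (x * y) m = gcd x m" "gcd (x * y) n = gcd y n"
      by (simp_all add: gcd_mult_right_right_cancel gcd_mult_right_left_cancel gcd.commute)
    then show "gcd (x * y) m = x" "gcd (x * y) n = y"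
      using that by (simp_all add: gcd_nat.absorb1)
  qed
  have "inj_on ?f (?D m \<times> ?D n)"
    by (rule inj_on_inverseI[where g = "\<lambda>d. (gcd d m, gcd d n)"]) (auto simp: recover)
  moreover have "?f ` (?D m \<times> ?D n) = ?D (m * n)"
  proof (intro equalityI subsetI)
    fix d assume "d \<in> ?D (m * n)"
    then obtain x y where "d = x * y" "x dvd m" "y dvd n"
      by (auto elim: dvd_productE)
    then show "d \<in> ?f ` (?D m \<times> ?D n)" by force
  qed (auto intro: mult_dvd_mono)
  ultimately have "card (?D (m * n)) = card (?D m \<times> ?D n)"
    by (metis card_image)
  then show ?thesis by (simp add: tau_def card_cartesian_product)
qed

lemma tau_prime_power:
  assumes "prime p"
  shows "tau (p ^ e) = e + 1"
proof -
  have "{d. d dvd p ^ e} = (\<lambda>i. p ^ i) ` {..e}"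
    using assms by (auto simp: divides_primepow_nat)
  moreover have "inj_on (\<lambda>i. p ^ i) {..e}"
    using prime_gt_1_nat[OF assms] by (simp add: inj_on_def)
  ultimately show ?thesis by (simp add: tau_def card_image)
qed

lemma tau_prime_power_mult:
  assumes "prime p" "\<not> p dvd m"
  shows "tau (p ^ e * m) = (e + 1) * tau m"
  using assms by (simp add: tau_mult_coprime tau_prime_power prime_imp_coprime)

lemma tau_pos:
  assumes "n > 0"
  shows "tau n > 0"
  using assms by (auto simp: tau_def card_gt_0_iff)

lemma card_le_tau:
  assumes "n > 0" "\<And>d. d \<in> D \<Longrightarrow> d dvd n"
  shows "card D \<le> tau n"
  unfolding tau_def using assms by (intro card_mono) auto

lemma four_le_tau_mult:
  assumes "1 < u" "u < v"
  shows "4 \<le> tau (u * v)"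
proof -
  have "1 * v < u * v" using assms by (intro mult_strict_right_mono) auto
  then have "card {1, u, v, u * v} = 4" using assms by auto
  moreover have "card {1, u, v, u * v} \<le> tau (u * v)"
    using assms by (intro card_le_tau) auto
  ultimately show ?thesis by simp
qed

text \<open>The involution \<open>d \<mapsto> n div d\<close> exchanges the divisors below the square root of \<open>n\<close> with
  those above it.\<close>

lemma even_tau_nonsquare:
  assumes "\<And>d. d\<^sup>2 \<noteq> n"
  shows "even (tau n)"
proof -
  have n: "n > 0" using assms[of 0] by simp
  let ?S = "{d. d dvd n \<and> d\<^sup>2 < n}"
  let ?L = "{d. d dvd n \<and> n < d\<^sup>2}"
  have swap: "n div d dvd n \<and> n div (n div d) = d \<and>
      (d\<^sup>2 < n \<longrightarrow> n < (n div d)\<^sup>2) \<and> (n < d\<^sup>2 \<longrightarrow> (n div d)\<^sup>2 < n)" if "d dvd n" for d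
  proof -
    obtain c where c: "n = d * c" using \<open>d dvd n\<close> by blast
    then have "d > 0" "c > 0" using n by auto
    then show ?thesis using c by (auto simp: power2_eq_square)
  qed
  have "bij_betw (\<lambda>d. n div d) ?S ?L"
    by (rule bij_betw_byWitness[where f' = "\<lambda>d. n div d"]) (use swap in auto)
  then have "card ?S = card ?L" by (rule bij_betw_same_card)
  moreover have "card {d. d dvd n} = card (?S \<union> ?L)"
    using assms by (intro arg_cong[where f = card]) (auto simp: neq_iff)
  moreover have "card (?S \<union> ?L) = card ?S + card ?L"
    using n by (intro card_Un_disjoint) auto
  ultimately show ?thesis by (simp add: tau_def)
qed

lemma even_tau_below_square:
  assumes "1 \<le> j" "j \<le> 2 * k - 2"
  shows "even (tau (k\<^sup>2 - j))"
proof (rule even_tau_nonsquare)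
  fix d
  obtain l where k: "k = Suc l" using assms by (cases k) auto
  have eq: "k\<^sup>2 = l\<^sup>2 + 2 * l + 1" by (simp add: k power2_eq_square)
  show "d\<^sup>2 \<noteq> k\<^sup>2 - j"
  proof
    assume "d\<^sup>2 = k\<^sup>2 - j"
    then have "l\<^sup>2 < d\<^sup>2" "d\<^sup>2 < (Suc l)\<^sup>2" using assms eq k by auto
    then have "l < d" "d < Suc l" by (meson power_less_imp_less_base zero_le)+
    then show False by simp
  qed
qed

section \<open>The sets of offsets and values\<close>

lemma finite_admissible: "finite (admissible k)"
  by (rule finite_subset[of _ "{..2 * k - 2}"]) (auto simp: admissible_def)

lemma finite_E: "finite (E k)"
  by (simp add: E_def finite_admissible)

lemma value_in_E: "j \<in> admissible k \<Longrightarrow> int (tau (k\<^sup>2 - j)) - int j \<in> E k"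
  by (auto simp: E_def)

lemma one_admissible:
  assumes "k \<ge> 2"
  shows "1 \<in> admissible k"
proof -
  have "1 < k\<^sup>2" using assms by (intro one_less_power) auto
  then have "k\<^sup>2 - 1 > 0" by simp
  then show ?thesis using assms tau_pos[of "k\<^sup>2 - 1"] by (simp add: admissible_def)
qed

lemma two_admissible:
  assumes "k \<ge> 2"
  shows "2 \<in> admissible k"
proof -
  have "2 * 2 \<le> k\<^sup>2" using mult_le_mono[OF assms assms] by (simp add: power2_eq_square)
  then have "k\<^sup>2 - 2 > 0" by simp
  moreover have "even (tau (k\<^sup>2 - 2))" using assms by (intro even_tau_below_square) auto
  ultimately have "tau (k\<^sup>2 - 2) \<ge> 2" using tau_pos[of "k\<^sup>2 - 2"] by (auto elim!: evenE)
  then show ?thesis using assms by (simp add: admissible_def)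
qed

lemma four_admissible:
  assumes "k \<ge> 4"
  shows "4 \<in> admissible k"
proof -
  have fac: "k\<^sup>2 - 4 = (k - 2) * (k + 2)"
    using assms by (simp add: power2_eq_square algebra_simps diff_mult_distrib)
  have "4 \<le> tau ((k - 2) * (k + 2))" using assms by (intro four_le_tau_mult) auto
  then show ?thesis using assms fac by (simp add: admissible_def)
qed

section \<open>Lower bounds valid at every level\<close>

lemma E_parity:
  assumes "j \<in> admissible k"
  shows "even (int (tau (k\<^sup>2 - j)) - int j) \<longleftrightarrow> even j"
  using assms even_tau_below_square[of j k] by (simp add: admissible_def)

lemma card_E_ge_2:
  assumes "k \<ge> 2"
  shows "card (E k) \<ge> 2"
proof -
  let ?f = "\<lambda>j. int (tau (k\<^sup>2 - j)) - int j"
  have "?f 1 \<noteq> ?f 2"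
    using E_parity[OF one_admissible[OF assms]] E_parity[OF two_admissible[OF assms]]
    by (metis even_numeral odd_one)
  then have "card {?f 1, ?f 2} = 2" by simp
  moreover have "card {?f 1, ?f 2} \<le> card (E k)"
    using value_in_E[OF one_admissible[OF assms]] value_in_E[OF two_admissible[OF assms]]
    by (intro card_mono finite_E) auto
  ultimately show ?thesis by simp
qed

text \<open>The two factorisations that make the residue classes \<open>3\<close> and \<open>5\<close> modulo \<open>8\<close> special. In
  the second one the residue \<open>3\<close> modulo \<open>4\<close> serves to exclude squares.\<close>

lemma three_five_mod_8_factors:
  fixes k :: nat
  assumes "[k = 3] (mod 8) \<or> [k = 5] (mod 8)"
  obtains m n where "k\<^sup>2 - 1 = 2 ^ 3 * m" "odd m" "k\<^sup>2 - 3 = 2 ^ 1 * n" "n mod 4 = 3"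
proof -
  have "k mod 8 = 3 \<or> k mod 8 = 5" using assms by (simp add: cong_def)
  then consider t where "k = 8 * t + 3" | t where "k = 8 * t + 5"
    by (metis mult_div_mod_eq)
  then show thesis
  proof cases
    case 1
    have "k\<^sup>2 = 64 * t\<^sup>2 + 48 * t + 9" by (simp add: 1 power2_eq_square algebra_simps)
    then show thesis
      by (intro that[of "8 * t\<^sup>2 + 6 * t + 1" "32 * t\<^sup>2 + 24 * t + 3"]; simp?) presburger
  next
    case 2
    have "k\<^sup>2 = 64 * t\<^sup>2 + 80 * t + 25" by (simp add: 2 power2_eq_square algebra_simps)
    then show thesis
      by (intro that[of "8 * t\<^sup>2 + 10 * t + 3" "32 * t\<^sup>2 + 40 * t + 11"]; simp?) presburger
  qed
qed

lemma three_mod_4_not_square: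
  fixes n :: nat
  assumes "n mod 4 = 3"
  shows "d\<^sup>2 \<noteq> n"
proof
  assume "d\<^sup>2 = n"
  then have sq: "(d mod 4)\<^sup>2 mod 4 = 3" using assms by (simp add: power_mod)
  have "d mod 4 \<in> {0, 1, 2, 3}" by auto
  then show False using sq by auto
qed

lemma tau_three_five_mod_8:
  fixes k :: nat
  assumes "[k = 3] (mod 8) \<or> [k = 5] (mod 8)"
  shows "4 dvd tau (k\<^sup>2 - 1)" "4 dvd tau (k\<^sup>2 - 3)" "tau (k\<^sup>2 - 3) \<ge> 4"
proof -
  obtain m n where mn: "k\<^sup>2 - 1 = 2 ^ 3 * m" "odd m" "k\<^sup>2 - 3 = 2 ^ 1 * n" "n mod 4 = 3"
    using three_five_mod_8_factors[OF assms] .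
  show "4 dvd tau (k\<^sup>2 - 1)"
    using tau_prime_power_mult[of 2 m 3] mn by simp
  have "odd n" "n > 0" using mn(4) by presburger+
  have "even (tau n)"
    using three_mod_4_not_square[OF mn(4)] by (rule even_tau_nonsquare)
  moreover have "tau (k\<^sup>2 - 3) = 2 * tau n"
    using tau_prime_power_mult[of 2 n 1] mn(3) \<open>odd n\<close> by simp
  ultimately show dvd: "4 dvd tau (k\<^sup>2 - 3)" by auto
  have "tau (k\<^sup>2 - 3) > 0" using \<open>tau (k\<^sup>2 - 3) = 2 * tau n\<close> tau_pos[OF \<open>n > 0\<close>] by simp
  with dvd show "tau (k\<^sup>2 - 3) \<ge> 4" by (rule dvd_imp_le)
qed

lemma three_admissible:
  assumes "k \<ge> 2" "[k = 3] (mod 8) \<or> [k = 5] (mod 8)"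
  shows "3 \<in> admissible k"
proof -
  have "k \<noteq> 2" using assms by (auto simp: cong_def)
  then show ?thesis
    using assms tau_three_five_mod_8(3)[OF assms(2)] by (simp add: admissible_def)
qed

lemma card_E_ge_3:
  assumes "k \<ge> 2" "[k = 3] (mod 8) \<or> [k = 5] (mod 8)"
  shows "card (E k) \<ge> 3"
proof -
  let ?f = "\<lambda>j. int (tau (k\<^sup>2 - j)) - int j"
  note adm = one_admissible[OF assms(1)] two_admissible[OF assms(1)] three_admissible[OF assms]
  have "?f 1 \<noteq> ?f 2" "?f 3 \<noteq> ?f 2"
    using E_parity[OF adm(1)] E_parity[OF adm(2)] E_parity[OF adm(3)]
    by (metis even_numeral odd_one odd_numeral)+
  moreover have "?f 1 \<noteq> ?f 3"
    using tau_three_five_mod_8(1,2)[OF assms(2)] by presburger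
  ultimately have "card {?f 1, ?f 2, ?f 3} = 3" by auto
  moreover have "card {?f 1, ?f 2, ?f 3} \<le> card (E k)"
    using adm[THEN value_in_E] by (intro card_mono finite_E) auto
  ultimately show ?thesis by simp
qed

lemma a_ge_3:
  assumes "k \<ge> 3"
  shows "a k \<ge> 3"
proof -
  have "\<exists>j\<in>admissible k. j > 2"
  proof (cases "k = 3")
    case True
    then have "3 \<in> admissible k" by (intro three_admissible) (auto simp: cong_def)
    then show ?thesis by (rule bexI[rotated]) simp
  next
    case False
    then have "4 \<in> admissible k" using assms by (intro four_admissible) simp
    then show ?thesis by (rule bexI[rotated]) simp
  qed
  then obtain j where j: "j \<in> admissible k" "j > 2" by blast
  then have "card {1, 2, j} = 3" by auto
  moreover have "card {1, 2, j} \<le> a k"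
    unfolding a_def using assms j one_admissible[of k] two_admissible[of k]
    by (intro card_mono finite_admissible) auto
  ultimately show ?thesis by simp
qed

section \<open>Partial sums\<close>

lemma sum_a_ge: "(\<Sum>k=2..K. real (a k)) \<ge> 3 * real K - 6"
proof (cases "K \<ge> 2")
  case True
  then show ?thesis
  proof (induction K rule: nat_induct_at_least)
    case base
    show ?case by (simp add: sum_nonneg)
  next
    case (Suc K)
    have "real (a (Suc K)) \<ge> 3" using a_ge_3[of "Suc K"] Suc.hyps by simp
    then show ?case using Suc by simp
  qed
qed simp

text \<open>The two quotients count the \<open>k \<le> K\<close> congruent to \<open>3\<close> and to \<open>5\<close> modulo \<open>8\<close>.\<close>

lemma sum_card_E_ge_count:
  assumes "K \<ge> 2"
  shows "2 * (K - 1) + (K + 5) div 8 + (K + 3) div 8 \<le> (\<Sum>k=2..K. card (E k))"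
  using assms
proof (induction K rule: nat_induct_at_least)
  case base
  show ?case using card_E_ge_2[of 2] by simp
next
  case (Suc K)
  have "card (E (Suc K)) \<ge> (if Suc K mod 8 = 3 \<or> Suc K mod 8 = 5 then 3 else 2)"
    using card_E_ge_2[of "Suc K"] card_E_ge_3[of "Suc K"] Suc.hyps by (auto simp: cong_def)
  moreover have "2 * (Suc K - 1) + (Suc K + 5) div 8 + (Suc K + 3) div 8 =
      2 * (K - 1) + (K + 5) div 8 + (K + 3) div 8 +
      (if Suc K mod 8 = 3 \<or> Suc K mod 8 = 5 then 3 else 2)"
  proof -
    have "Suc (K + 5) mod 8 = 0 \<longleftrightarrow> Suc K mod 8 = 3"
      "Suc (K + 3) mod 8 = 0 \<longleftrightarrow> Suc K mod 8 = 5" by presburger+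
    then have "(Suc K + 5) div 8 = (K + 5) div 8 + (if Suc K mod 8 = 3 then 1 else 0)"
      "(Suc K + 3) div 8 = (K + 3) div 8 + (if Suc K mod 8 = 5 then 1 else 0)"
      unfolding add_Suc div_Suc by simp_all
    moreover have "2 * (Suc K - 1) = 2 * (K - 1) + 2" using Suc.hyps by simp
    ultimately show ?thesis by simp
  qed
  moreover have "(\<Sum>k=2..Suc K. card (E k)) = (\<Sum>k=2..K. card (E k)) + card (E (Suc K))"
    using Suc.hyps by simp
  ultimately show ?case using Suc.IH by linarith
qed

lemma sum_card_E_ge:
  assumes "K \<ge> 2"
  shows "(\<Sum>k=2..K. real (card (E k))) \<ge> 9 / 4 * real K - 3"
proof -
  have "K + 5 < 8 * ((K + 5) div 8) + 8" "K + 3 < 8 * ((K + 3) div 8) + 8"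
    by (simp_all only: dividend_less_times_div zero_less_numeral add.commute)
  then have "9 * K \<le> 4 * (2 * (K - 1) + (K + 5) div 8 + (K + 3) div 8) + 12"
    using assms by (simp add: diff_mult_distrib2)
  then have "9 * K \<le> 4 * (\<Sum>k=2..K. card (E k)) + 12"
    using sum_card_E_ge_count[OF assms] by linarith
  then have "9 * real K \<le> 4 * real (\<Sum>k=2..K. card (E k)) + 12"
    by linarith
  then show ?thesis by simp
qed

section \<open>Levels with many values\<close>

text \<open>Among the members of the progression up to \<open>N\<close>, at least those with index in
  \<open>{1..(N - r) div q}\<close> and at most those with index in \<open>{..N div q}\<close> are counted, so the count
  differs from \<open>N / q\<close> by a bounded amount.\<close>

lemma arith_prog_density:
  assumes "q \<ge> 1"
  shows "has_natural_density (arith_prog r q) (1 / real q)"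
  unfolding has_natural_density_def
proof (rule tendsto_sandwich)
  let ?S = "\<lambda>N. {k \<in> arith_prog r q. 1 \<le> k \<and> k \<le> N}"
  have lower: "real N / real q - (real r / real q + 1) \<le> real (card (?S N))" for N
  proof -
    let ?n = "(N - r) div q"
    have "(\<lambda>n. r + n * q) ` {1..?n} \<subseteq> ?S N"
    proof (intro image_subsetI)
      fix n assume n: "n \<in> {1..?n}"
      then have "n * q \<le> N - r" "1 \<le> n * q"
        using assms by (simp_all add: less_eq_div_iff_mult_less_eq)
      then have "1 \<le> r + n * q" "r + n * q \<le> N" by linarith+
      then show "r + n * q \<in> ?S N" by (auto simp: arith_prog_def)
    qed
    moreover have "inj_on (\<lambda>n. r + n * q) {1..?n}" using assms by (simp add: inj_on_def)
    ultimately have "?n \<le> card (?S N)"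
      using card_mono[of "?S N" "(\<lambda>n. r + n * q) ` {1..?n}"] by (simp add: card_image)
    moreover have "N \<le> r + q * ?n + q"
    proof -
      have "N - r < q * ?n + q"
        using assms dividend_less_times_div[of q "N - r"] by simp
      then show ?thesis by simp
    qed
    ultimately have "N \<le> r + q * card (?S N) + q"
      by (meson add_le_mono le_refl mult_le_mono order_trans)
    then have "real N \<le> real (r + q * card (?S N) + q)" by (simp only: of_nat_le_iff)
    then show ?thesis using assms by (simp add: field_simps)
  qed
  have upper: "real (card (?S N)) \<le> real N / real q + 1" for N
  proof -
    have "?S N \<subseteq> (\<lambda>n. r + n * q) ` {..N div q}"
    proof
      fix k assume "k \<in> ?S N"
      then obtain n where n: "k = r + n * q" "k \<le> N" by (auto simp: arith_prog_def)
      then have "n \<le> N div q" using assms by (simp add: less_eq_div_iff_mult_less_eq)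
      then show "k \<in> (\<lambda>n. r + n * q) ` {..N div q}" using n by blast
    qed
    then have "card (?S N) \<le> card {..N div q}"
      by (rule surj_card_le[rotated]) simp
    then have "real (card (?S N)) \<le> real (N div q) + 1" by simp
    also have "real (N div q) \<le> real N / real q" by (rule of_nat_div_le_of_nat)
    finally show ?thesis by simp
  qed
  show "\<forall>\<^sub>F N in sequentially. 1 / real q - (real r / real q + 1) / real N
      \<le> real (card (?S N)) / real N"
    using eventually_gt_at_top[of 0]
  proof eventually_elim
    case (elim N)
    then show ?case using divide_right_mono[OF lower[of N], of "real N"]
      by (simp add: diff_divide_distrib)
  qed
  show "\<forall>\<^sub>F N in sequentially. real (card (?S N)) / real N \<le> 1 / real q + 1 / real N"
    using eventually_gt_at_top[of 0]
  proof eventually_elim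
    case (elim N)
    then show ?case using divide_right_mono[OF upper[of N], of "real N"]
      by (simp add: add_divide_distrib)
  qed
  show "(\<lambda>N. 1 / real q - (real r / real q + 1) / real N) \<longlonglongrightarrow> 1 / real q"
    using tendsto_diff[OF tendsto_const lim_const_over_n] by fastforce
  show "(\<lambda>N. 1 / real q + 1 / real N) \<longlonglongrightarrow> 1 / real q"
    using tendsto_add[OF tendsto_const lim_const_over_n] by fastforce
qed

text \<open>One congruence prescribes the exact power of \<open>p\<close> dividing \<open>k - i\<close>. Since \<open>p\<close> divides
  \<open>k - i\<close> but not \<open>2 * i\<close>, it does not divide \<open>k + i\<close>.\<close>

lemma Suc_dvd_tau_diff_squares:
  fixes k :: nat
  assumes "prime p" "2 * i < p" "i \<ge> 1" "e \<ge> 1" "i < k"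
    and "[k = i + p ^ e] (mod p ^ Suc e)"
  shows "Suc e dvd tau (k\<^sup>2 - i\<^sup>2)"
proof -
  define l where "l = k - i"
  have k: "k = i + l" using assms l_def by simp
  have "[l = p ^ e] (mod p ^ Suc e)"
    using assms(6) unfolding k by (simp only: cong_add_lcancel_nat)
  then have "l mod p ^ Suc e = p ^ e"
    using prime_gt_1_nat[OF assms(1)] by (simp add: cong_def)
  then have "l = p ^ Suc e * (l div p ^ Suc e) + p ^ e"
    by (metis mult_div_mod_eq)
  also have "\<dots> = p ^ e * (p * (l div p ^ Suc e) + 1)"
    by (simp add: algebra_simps)
  finally obtain c where c: "l = p ^ e * (p * c + 1)" ..
  have "\<not> p dvd p * c + 1"
    using assms(1) by (metis dvd_add_right_iff dvd_triv_left not_prime_unit)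
  moreover have "\<not> p dvd l + 2 * i"
  proof
    assume "p dvd l + 2 * i"
    moreover have "p dvd l" using c assms(4) by (simp add: dvd_power)
    ultimately have "p dvd 2 * i" by (simp add: dvd_add_right_iff)
    then show False using assms(2,3) by (auto dest: dvd_imp_le)
  qed
  ultimately have "\<not> p dvd (p * c + 1) * (l + 2 * i)"
    using prime_dvd_multD[OF assms(1)] by blast
  moreover have "k\<^sup>2 - i\<^sup>2 = l * (l + 2 * i)"
    by (simp add: k power2_eq_square algebra_simps)
  then have "k\<^sup>2 - i\<^sup>2 = p ^ e * ((p * c + 1) * (l + 2 * i))"
    using c by (metis mult.assoc)
  ultimately have "tau (k\<^sup>2 - i\<^sup>2) = Suc e * tau ((p * c + 1) * (l + 2 * i))"
    using tau_prime_power_mult[OF assms(1)] by simp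
  then show ?thesis by (metis dvd_triv_left)
qed

lemma card_E_ge_of_dvd_tau:
  assumes "2 * k \<ge> R\<^sup>2 + 2" "k > R"
    and "\<And>i. i \<in> {1..R} \<Longrightarrow> Suc (R\<^sup>2) dvd tau (k\<^sup>2 - i\<^sup>2)"
  shows "card (E k) \<ge> R"
proof -
  let ?f = "\<lambda>j. int (tau (k\<^sup>2 - j)) - int j"
  have le: "i\<^sup>2 \<le> R\<^sup>2" if "i \<in> {1..R}" for i
    using that by (simp add: power_mono)
  have adm: "i\<^sup>2 \<in> admissible k" if "i \<in> {1..R}" for i
  proof -
    have "i\<^sup>2 < k\<^sup>2" using that assms(2) by (intro power_strict_mono) auto
    then have "Suc (R\<^sup>2) \<le> tau (k\<^sup>2 - i\<^sup>2)"
      using assms(3)[OF that] tau_pos[of "k\<^sup>2 - i\<^sup>2"] by (intro dvd_imp_le) auto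
    then have "i\<^sup>2 \<le> tau (k\<^sup>2 - i\<^sup>2)" "i\<^sup>2 \<le> 2 * k - 2"
      using le[OF that] assms(1) by linarith+
    then show ?thesis using that by (simp add: admissible_def)
  qed
  \<comment> \<open>The value at \<open>i\<^sup>2\<close> is \<open>- i\<^sup>2\<close> modulo \<open>R\<^sup>2 + 1\<close>, and numbers up to \<open>R\<^sup>2\<close> are congruent to
    that modulus only if they are equal.\<close>
  have "inj_on (\<lambda>i. ?f (i\<^sup>2)) {1..R}"
  proof (rule inj_onI)
    fix i i' assume i: "i \<in> {1..R}" "i' \<in> {1..R}" and eq: "?f (i\<^sup>2) = ?f (i'\<^sup>2)"
    have "tau (k\<^sup>2 - i\<^sup>2) + i'\<^sup>2 = tau (k\<^sup>2 - i'\<^sup>2) + i\<^sup>2" using eq by linarith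
    then have "(tau (k\<^sup>2 - i\<^sup>2) + i'\<^sup>2) mod Suc (R\<^sup>2) = (tau (k\<^sup>2 - i'\<^sup>2) + i\<^sup>2) mod Suc (R\<^sup>2)"
      by simp
    then have "i'\<^sup>2 mod Suc (R\<^sup>2) = i\<^sup>2 mod Suc (R\<^sup>2)"
      using assms(3)[OF i(1)] assms(3)[OF i(2)]
      by (metis add.left_neutral dvd_imp_mod_0 mod_add_left_eq)
    then have "i'\<^sup>2 = i\<^sup>2" using le[OF i(1)] le[OF i(2)] by simp
    then show "i = i'" by simp
  qed
  then have "card ((\<lambda>i. ?f (i\<^sup>2)) ` {1..R}) = R" by (simp add: card_image)
  moreover have "card ((\<lambda>i. ?f (i\<^sup>2)) ` {1..R}) \<le> card (E k)"
    using adm[THEN value_in_E] by (intro card_mono finite_E image_subsetI)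
  ultimately show ?thesis by simp
qed

text \<open>Taking all primes above \<open>2 * R\<close> makes the condition \<open>2 * i < p i\<close> hold for every \<open>i \<le> R\<close>
  at once, and taking them distinct makes the moduli coprime.\<close>

lemma many_values_progression:
  assumes "R \<ge> (1::nat)"
  obtains r q where "q \<ge> 1"
    "\<forall>\<^sub>F k in sequentially. k \<in> arith_prog r q \<longrightarrow> card (E k) \<ge> R"
proof -
  have "infinite ({p::nat. prime p} - {..2 * R})"
    using primes_infinite by simp
  then obtain p :: "nat \<Rightarrow> nat" where p: "inj p" "range p \<subseteq> {p. prime p} - {..2 * R}"
    by (metis infinite_countable_subset)
  then have prime: "prime (p i)" and large: "2 * R < p i" for i
    by (auto simp: image_subset_iff not_le)
  define m where "m i = p i ^ Suc (R\<^sup>2)" for i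
  have "\<exists>x. \<forall>i\<in>{1..R}. [x = i + p i ^ R\<^sup>2] (mod m i)"
  proof (rule chinese_remainder_nat)
    show "\<forall>i\<in>{1..R}. \<forall>j\<in>{1..R}. i \<noteq> j \<longrightarrow> coprime (m i) (m j)"
      using primes_coprime[OF prime prime] p(1)
      by (auto simp: m_def inj_eq simp del: power_Suc)
  qed simp
  then obtain r where r: "[r = i + p i ^ R\<^sup>2] (mod m i)" if "i \<in> {1..R}" for i
    by blast
  define q where "q = (\<Prod>i\<in>{1..R}. m i)"
  have "q \<ge> 1"
    using prime_gt_0_nat[OF prime] by (simp add: q_def m_def Suc_le_eq)
  moreover have "\<forall>\<^sub>F k in sequentially. k \<in> arith_prog r q \<longrightarrow> card (E k) \<ge> R"
    using eventually_ge_at_top[of "R\<^sup>2 + 2"]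
  proof eventually_elim
    case (elim k)
    have "R \<le> R\<^sup>2" by (simp add: power2_eq_square)
    show ?case
    proof
      assume "k \<in> arith_prog r q"
      then obtain n where k: "k = r + n * q" by (auto simp: arith_prog_def)
      show "card (E k) \<ge> R"
      proof (rule card_E_ge_of_dvd_tau)
        fix i assume i: "i \<in> {1..R}"
        have "m i dvd q" unfolding q_def using i by (intro dvd_prodI) auto
        then have "[k = r] (mod m i)"
          by (simp add: k cong_add_lcancel_0_nat cong_0_iff dvd_mult)
        with r[OF i] have "[k = i + p i ^ R\<^sup>2] (mod m i)" by (rule cong_trans[rotated])
        then show "Suc (R\<^sup>2) dvd tau (k\<^sup>2 - i\<^sup>2)"
          using prime[of i] large[of i] i assms elim \<open>R \<le> R\<^sup>2\<close> unfolding m_def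
          by (intro Suc_dvd_tau_diff_squares) auto
      qed (use elim \<open>R \<le> R\<^sup>2\<close> in auto)
    qed
  qed
  ultimately show thesis by (rule that)
qed

theorem proposition7p5:
  "(\<forall>k\<ge>2. card (E k) \<ge> 2) \<and>
   (\<forall>k\<ge>3. a k \<ge> 3) \<and>
   (\<forall>k\<ge>2. [k = 3] (mod 8) \<or> [k = 5] (mod 8) \<longrightarrow> card (E k) \<ge> 3) \<and>
   (\<exists>g :: nat \<Rightarrow> real. g \<in> O(\<lambda>_. 1) \<and>
      (\<forall>K\<ge>2. (\<Sum>k=2..K. real (a k)) \<ge> 3 * real K + g K)) \<and>
   (\<exists>g :: nat \<Rightarrow> real. g \<in> O(\<lambda>_. 1) \<and>
      (\<forall>K\<ge>2. (\<Sum>k=2..K. real (card (E k))) \<ge> 9 / 4 * real K + g K)) \<and>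
   (\<forall>R\<ge>(1::nat). \<exists>r q d. q \<ge> 1 \<and> d > 0 \<and> has_natural_density (arith_prog r q) d \<and>
      (\<forall>\<^sub>F k in sequentially. k \<in> arith_prog r q \<longrightarrow> card (E k) \<ge> R))"
proof (intro conjI allI impI)
  show "card (E k) \<ge> 2" if "k \<ge> 2" for k
    using that by (rule card_E_ge_2)
  show "a k \<ge> 3" if "k \<ge> 3" for k
    using that by (rule a_ge_3)
  show "card (E k) \<ge> 3" if "k \<ge> 2" "[k = 3] (mod 8) \<or> [k = 5] (mod 8)" for k
    using that by (rule card_E_ge_3)
  show "\<exists>g :: nat \<Rightarrow> real. g \<in> O(\<lambda>_. 1) \<and>
      (\<forall>K\<ge>2. (\<Sum>k=2..K. real (a k)) \<ge> 3 * real K + g K)"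
    by (rule exI[of _ "\<lambda>_. -6"]) (use sum_a_ge in auto)
  show "\<exists>g :: nat \<Rightarrow> real. g \<in> O(\<lambda>_. 1) \<and>
      (\<forall>K\<ge>2. (\<Sum>k=2..K. real (card (E k))) \<ge> 9 / 4 * real K + g K)"
    by (rule exI[of _ "\<lambda>_. -3"]) (use sum_card_E_ge in auto)
  show "\<exists>r q d. q \<ge> 1 \<and> d > 0 \<and> has_natural_density (arith_prog r q) d \<and>
      (\<forall>\<^sub>F k in sequentially. k \<in> arith_prog r q \<longrightarrow> card (E k) \<ge> R)" if R: "R \<ge> 1" for R :: nat
  proof -
    obtain r q where "q \<ge> 1" "\<forall>\<^sub>F k in sequentially. k \<in> arith_prog r q \<longrightarrow> card (E k) \<ge> R"
      using many_values_progression[OF R] .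
    then show ?thesis
      using arith_prog_density[of q r] by (intro exI[of _ r] exI[of _ q] exI[of _ "1 / real q"]) simp
  qed
qed

end
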